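(* Let $a:\{0,1,2,\dots\}\to(0,+\infty)$, let $(X_1,\dots,X_N)$ be distributed according to the $\mathcal{M}^{(a)}_{N,r}$-model, and define $S_n=X_1+\dots+X_n$ with $1\le n\le N$. Let $s$ be such that $P\{S_n=s\}>0$. Then, conditionally on the event $\{S_n=s\}$, the variables $X_1,\dots,X_n$ are distributed as an $\mathcal{M}^{(a)}_{n,s}$-model.
   Context: For integers $n\ge1$, $r\ge0$, $A_{n,r}$ is the set of vectors $(x_1,\dots,x_n)$ of non-negative integers with $\sum_{j=1}^n x_j=r$. Given $a:\{0,1,2,\dots\}\to(0,+\infty)$, a random vector $(X_1,\dots,X_n)$ with values in $A_{n,r}$ is distributed according to the $\mathcal{M}^{(a)}_{n,r}$-model if $$P\{X_1=x_1,\dots,X_n=x_n\}=\frac{\prod_{j=1}^n a(x_j)}{C^{(a)}_{n,r}}\quad\text{for }(x_1,\dots,x_n)\in A_{n,r},\qquad C^{(a)}_{n,r}=\sum_{\xi\in A_{n,r}}\prod_{j=1}^n a(\xi_j).$$ *)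

theory Defs
  imports "HOL-Probability.Probability"
begin

text \<open>Vectors \<open>(x\<^sub>1, \<dots>, x\<^sub>n)\<close> are functions on the index set \<open>{1..n}\<close>, extended by
  \<open>undefined\<close> outside it so that each vector is represented exactly once.\<close>

definition simplex_vectors :: "nat \<Rightarrow> nat \<Rightarrow> (nat \<Rightarrow> nat) set" where
  "simplex_vectors n r = {x \<in> {1..n} \<rightarrow>\<^sub>E UNIV. (\<Sum>j=1..n. x j) = r}"

definition norm_const :: "(nat \<Rightarrow> real) \<Rightarrow> nat \<Rightarrow> nat \<Rightarrow> real" where
  "norm_const a n r = (\<Sum>\<xi>\<in>simplex_vectors n r. \<Prod>j=1..n. a (\<xi> j))"

text \<open>The sum in \<^const>\<open>norm_const\<close> is a genuine finite sum.\<close>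

lemma finite_simplex_vectors: "finite (simplex_vectors n r)"
proof (rule finite_subset)
  show "simplex_vectors n r \<subseteq> {1..n} \<rightarrow>\<^sub>E {..r}"
  proof
    fix x assume x: "x \<in> simplex_vectors n r"
    have "x i \<le> (\<Sum>j=1..n. x j)" if "i \<in> {1..n}" for i
      using that by (intro member_le_sum) auto
    with x show "x \<in> {1..n} \<rightarrow>\<^sub>E {..r}"
      by (auto simp: simplex_vectors_def PiE_iff)
  qed
  show "finite ({1..n} \<rightarrow>\<^sub>E {..r})"
    by (intro finite_PiE) auto
qed

text \<open>Being distributed according to the model depends only on the law of
  \<open>(X 1, \<dots>, X n)\<close> under the probability measure \<open>M\<close>; hence the vector is required to take its
  values in \<^term>\<open>simplex_vectors n r\<close> almost surely. In particular the predicate can be applied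
  to a conditional probability measure on the same sample space.\<close>

definition M_model ::
  "(nat \<Rightarrow> real) \<Rightarrow> nat \<Rightarrow> nat \<Rightarrow> 'w measure \<Rightarrow> (nat \<Rightarrow> 'w \<Rightarrow> nat) \<Rightarrow> bool" where
  "M_model a n r M X \<longleftrightarrow>
     prob_space M \<and>
     (\<forall>j\<in>{1..n}. X j \<in> measurable M (count_space UNIV)) \<and>
     (AE \<omega> in M. (\<lambda>j\<in>{1..n}. X j \<omega>) \<in> simplex_vectors n r) \<and>
     (\<forall>x\<in>simplex_vectors n r.
        measure M {\<omega> \<in> space M. \<forall>j\<in>{1..n}. X j \<omega> = x j}
          = (\<Prod>j=1..n. a (x j)) / norm_const a n r)"

end

theory Submission
  imports Defs
begin

text \<open>The probability of \<open>{X\<^sub>1 = x\<^sub>1, \<dots>, X\<^sub>n = x\<^sub>n}\<close> with \<open>x\<close> in \<^term>\<open>simplex_vectors n s\<close> is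
  \<open>\<Prod>j\<le>n. a (x\<^sub>j)\<close> times a factor, coming from the remaining \<open>N - n\<close> coordinates, which depends on
  \<open>x\<close> only through \<open>s\<close>. Summing over \<open>x\<close> identifies \<open>P {S\<^sub>n = s}\<close> as that same factor times
  \<^term>\<open>norm_const a n s\<close>, and the factor cancels in the quotient.\<close>

definition tail_vectors :: "nat \<Rightarrow> nat \<Rightarrow> nat \<Rightarrow> nat \<Rightarrow> (nat \<Rightarrow> nat) set" where
  "tail_vectors n N s r = {y \<in> {Suc n..N} \<rightarrow>\<^sub>E UNIV. s + (\<Sum>j=Suc n..N. y j) = r}"

text \<open>Once the prefix is fixed, a vector is determined by its tail, so restriction to
  \<open>{Suc n..N}\<close> is a bijection onto \<open>tail_vectors n N s r\<close>. The target set
  is the same for every \<open>x\<close>, since the prefix enters the constraint only through its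
  sum \<open>s\<close>.\<close>

lemma sum_prod_fixed_prefix:
  fixes a :: "nat \<Rightarrow> real"
  assumes "n \<le> N" and x: "x \<in> simplex_vectors n s"
  shows "(\<Sum>z | z \<in> simplex_vectors N r \<and> (\<forall>j\<in>{1..n}. z j = x j). \<Prod>j=1..N. a (z j))
       = (\<Prod>j=1..n. a (x j)) * (\<Sum>y\<in>tail_vectors n N s r. \<Prod>j=Suc n..N. a (y j))"
proof -
  have split: "{1..N} = {1..n} \<union> {Suc n..N}" using \<open>n \<le> N\<close> by auto
  have sums: "sum f {1..N} = sum f {1..n} + sum f {Suc n..N}" for f :: "nat \<Rightarrow> nat"
    unfolding split by (rule sum.union_disjoint) auto
  have prods: "prod f {1..N} = prod f {1..n} * prod f {Suc n..N}" for f :: "nat \<Rightarrow> real"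
    unfolding split by (rule prod.union_disjoint) auto
  \<comment> \<open>Inverse of the restriction: glue the prefix \<open>x\<close> to a tail, leaving
    \<open>undefined\<close> outside \<open>{1..N}\<close> so that the result is
    extensional.\<close>
  let ?join = "\<lambda>y. \<lambda>j\<in>{1..N}. if j \<le> n then x j else y j"
  show ?thesis
    unfolding sum_distrib_left
  proof (rule sum.reindex_bij_witness[where i = ?join and j = "\<lambda>z. restrict z {Suc n..N}"])
    fix z assume z: "z \<in> {z. z \<in> simplex_vectors N r \<and> (\<forall>j\<in>{1..n}. z j = x j)}"
    then show "?join (restrict z {Suc n..N}) = z"
      by (auto simp: simplex_vectors_def PiE_iff extensional_def fun_eq_iff)
    have pre: "(\<Sum>j=1..n. z j) = s"
      using z x by (simp add: simplex_vectors_def)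
    show "restrict z {Suc n..N} \<in> tail_vectors n N s r"
      using z pre sums[of z] by (simp add: simplex_vectors_def tail_vectors_def)
    show "(\<Prod>j=1..n. a (x j)) * (\<Prod>j=Suc n..N. a (restrict z {Suc n..N} j)) = (\<Prod>j=1..N. a (z j))"
      using z prods[of "\<lambda>j. a (z j)"] by simp
  next
    fix y assume y: "y \<in> tail_vectors n N s r"
    then show "restrict (?join y) {Suc n..N} = y"
      by (auto simp: tail_vectors_def PiE_iff extensional_def fun_eq_iff)
    have "(\<Sum>j=1..n. ?join y j) = (\<Sum>j=1..n. x j)"
      using \<open>n \<le> N\<close> by (intro sum.cong) auto
    moreover have "(\<Sum>j=Suc n..N. ?join y j) = (\<Sum>j=Suc n..N. y j)"
      by (intro sum.cong) auto
    ultimately have "(\<Sum>j=1..N. ?join y j) = r"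
      using x y unfolding sums by (simp add: simplex_vectors_def tail_vectors_def)
    then show "?join y \<in> {z. z \<in> simplex_vectors N r \<and> (\<forall>j\<in>{1..n}. z j = x j)}"
      using \<open>n \<le> N\<close> unfolding simplex_vectors_def by auto
  qed
qed

theorem proposition6p5:
  fixes a :: "nat \<Rightarrow> real"
    and M :: "'w measure"
    and X :: "nat \<Rightarrow> 'w \<Rightarrow> nat"
    and N n r s :: nat
  assumes a_pos: "\<And>k. a k > 0"
    and model: "M_model a N r M X"
    and n_ge: "1 \<le> n"
    and n_le: "n \<le> N"
    and s_pos: "measure M {\<omega> \<in> space M. (\<Sum>j=1..n. X j \<omega>) = s} > 0"
  shows "M_model a n s
           (uniform_measure M {\<omega> \<in> space M. (\<Sum>j=1..n. X j \<omega>) = s}) X"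
proof -
  interpret prob_space M using model by (simp add: M_model_def)
  define E where "E = {\<omega> \<in> space M. (\<Sum>j=1..n. X j \<omega>) = s}"
  define W where "W x = (\<Prod>j=1..n. a (x j))" for x
  define K where "K = (\<Sum>y\<in>tail_vectors n N s r. \<Prod>j=Suc n..N. a (y j)) / norm_const a N r"
  define C where "C x = {\<omega> \<in> space M. \<forall>j\<in>{1..n}. X j \<omega> = x j}" for x

  have X [measurable]: "X j \<in> measurable M (count_space UNIV)" if "j \<in> {1..N}" for j
    using model that by (simp add: M_model_def)
  have X_le [measurable]: "X j \<in> measurable M (count_space UNIV)" if "j \<in> {1..n}" for j
    using that n_le by (intro X) auto
  have E_sets [measurable]: "E \<in> sets M" unfolding E_def by measurable
  have cyl: "{\<omega> \<in> space M. \<forall>j\<in>{1..m}. X j \<omega> = x j} \<in> sets M" if "m \<le> N" for m x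
  proof -
    have [measurable]: "X j \<in> measurable M (count_space UNIV)" if "j \<in> {1..m}" for j
      using that \<open>m \<le> N\<close> by (intro X) auto
    show ?thesis by measurable
  qed

  have prob_C: "prob (C x) = W x * K" if x: "x \<in> simplex_vectors n s" for x
  proof -
    let ?Z = "{z. z \<in> simplex_vectors N r \<and> (\<forall>j\<in>{1..n}. z j = x j)}"
    \<comment> \<open>The model prescribes probabilities of full vectors only, so the cylinder is
      split over all completions \<open>z\<close> of \<open>x\<close>. Exactly one completion occurs
      almost surely, namely the observed vector, because that vector lies in
      \<open>simplex_vectors N r\<close> only almost surely.\<close>
    have "prob (C x) = (\<Sum>z\<in>?Z. prob {\<omega> \<in> space M. \<forall>j\<in>{1..N}. X j \<omega> = z j})"
      unfolding C_def
    proof (rule prob_sum)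
      show "finite ?Z" by (simp add: finite_simplex_vectors)
      show "{\<omega> \<in> space M. \<forall>j\<in>{1..n}. X j \<omega> = x j} \<in> events" by (rule cyl[OF n_le])
      show "{\<omega> \<in> space M. \<forall>j\<in>{1..N}. X j \<omega> = z j} \<in> events" for z by (rule cyl) simp
      have "AE \<omega> in M. (\<lambda>j\<in>{1..N}. X j \<omega>) \<in> simplex_vectors N r"
        using model by (simp add: M_model_def)
      then show "AE \<omega> in M. (\<forall>z\<in>?Z. (\<forall>j\<in>{1..N}. X j \<omega> = z j) \<longrightarrow> (\<forall>j\<in>{1..n}. X j \<omega> = x j)) \<and>
          ((\<forall>j\<in>{1..n}. X j \<omega> = x j) \<longrightarrow> (\<exists>!z\<in>?Z. \<forall>j\<in>{1..N}. X j \<omega> = z j))"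
      proof (rule AE_mp, intro AE_I2 impI conjI ballI)
        fix \<omega> z j assume "z \<in> ?Z" "\<forall>j\<in>{1..N}. X j \<omega> = z j" "j \<in> {1..n}"
        then show "X j \<omega> = x j" using n_le by auto
      next
        fix \<omega>
        assume "(\<lambda>j\<in>{1..N}. X j \<omega>) \<in> simplex_vectors N r" "\<forall>j\<in>{1..n}. X j \<omega> = x j"
        then show "\<exists>!z. z \<in> ?Z \<and> (\<forall>j\<in>{1..N}. X j \<omega> = z j)"
          using n_le
          by (intro ex1I[where a = "\<lambda>j\<in>{1..N}. X j \<omega>"])
            (auto simp: simplex_vectors_def PiE_iff extensional_def fun_eq_iff)
      qed
    qed
    also have "\<dots> = (\<Sum>z\<in>?Z. (\<Prod>j=1..N. a (z j)) / norm_const a N r)"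
      using model by (intro sum.cong) (auto simp: M_model_def)
    also have "\<dots> = W x * K"
      using sum_prod_fixed_prefix[OF n_le x]
      by (simp add: W_def K_def flip: sum_divide_distrib)
    finally show ?thesis .
  qed

  have C_sub: "C x \<subseteq> E" if "x \<in> simplex_vectors n s" for x
    using that by (auto simp: C_def E_def simplex_vectors_def)
  \<comment> \<open>This splitting holds at every point: on \<open>E\<close> the observed prefix is
    itself the unique matching element of \<open>simplex_vectors n s\<close>.\<close>
  have "prob E = (\<Sum>x\<in>simplex_vectors n s. prob (C x))"
    unfolding E_def C_def
  proof (rule prob_sum)
    show "AE \<omega> in M. (\<forall>x\<in>simplex_vectors n s. (\<forall>j\<in>{1..n}. X j \<omega> = x j) \<longrightarrow> (\<Sum>j=1..n. X j \<omega>) = s) \<and>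
        ((\<Sum>j=1..n. X j \<omega>) = s \<longrightarrow> (\<exists>!x\<in>simplex_vectors n s. \<forall>j\<in>{1..n}. X j \<omega> = x j))"
    proof (intro AE_I2 impI conjI ballI)
      fix \<omega> assume "(\<Sum>j=1..n. X j \<omega>) = s"
      then show "\<exists>!x. x \<in> simplex_vectors n s \<and> (\<forall>j\<in>{1..n}. X j \<omega> = x j)"
        by (intro ex1I[where a = "\<lambda>j\<in>{1..n}. X j \<omega>"])
          (auto simp: simplex_vectors_def PiE_iff extensional_def fun_eq_iff)
    qed (auto simp: simplex_vectors_def)
  qed (use E_sets cyl[OF n_le] in \<open>auto simp: finite_simplex_vectors E_def\<close>)
  also have "\<dots> = norm_const a n s * K"
    by (simp add: prob_C norm_const_def W_def sum_distrib_right)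
  finally have prob_E: "prob E = norm_const a n s * K" .

  have E_pos: "prob E > 0" using s_pos by (simp add: E_def)
  then have E_nz: "emeasure M E \<noteq> 0" by (simp add: emeasure_eq_measure)
  have "measure (uniform_measure M E) (C x) = W x / norm_const a n s"
    if x: "x \<in> simplex_vectors n s" for x
  proof -
    have "measure (uniform_measure M E) (C x) = prob (E \<inter> C x) / prob E"
      using E_nz cyl[OF n_le] by (intro measure_uniform_measure) (auto simp: C_def)
    also have "E \<inter> C x = C x" using C_sub[OF x] by blast
    \<comment> \<open>The factor \<open>K\<close> can vanish in general, for instance if
      \<open>s > r\<close>. Here \<open>K = 0\<close> would give \<open>prob E = 0\<close>,
      contradicting \<open>E_pos\<close>, so \<open>K\<close> cancels.\<close>
    finally show ?thesis using E_pos by (cases "K = 0") (simp_all add: prob_C[OF x] prob_E)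
  qed
  \<comment> \<open>The conditional measure is concentrated on \<open>E\<close>, where the prefix
    sums to \<open>s\<close> by definition.\<close>
  moreover have "AE \<omega> in uniform_measure M E. (\<lambda>j\<in>{1..n}. X j \<omega>) \<in> simplex_vectors n s"
    by (rule AE_uniform_measureI) (auto simp: E_def simplex_vectors_def)
  moreover have "prob_space (uniform_measure M E)"
    using E_nz by (intro prob_space_uniform_measure) auto
  ultimately show ?thesis
    using X_le unfolding E_def[symmetric] by (simp add: M_model_def C_def W_def)
qed

end
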